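(* Let $k\ge2$ and let $\mathcal{T}'$ be a refinement of the time mesh $\mathcal{T}$. Then $\mathcal{X}_{\mathcal{T}}\subseteq\mathcal{X}_{\mathcal{T}'}$. If, additionally, for all $T\in\mathcal{T}\setminus\mathcal{T}'$ all elements of $\mathcal{T}_T$ or their successors are in $\mathcal{T}'$ (that is, each element of $\mathcal{T}_T$ either belongs to $\mathcal{T}'$ or is a union of elements of $\mathcal{T}'$), then also $\mathcal{Y}_{\mathcal{T}}\subseteq\mathcal{Y}_{\mathcal{T}'}$.
   Context: $V$ is a finite-dimensional Hilbert space, $t_{\rm end}>0$. A time mesh is $\mathcal{T}=\{T_i=[t_{i-1},t_i]: i=1,\dots,\#\mathcal{T}\}$ with $0=t_0<t_1<\dots<t_{\#\mathcal{T}}=t_{\rm end}$; for $T\in\mathcal{T}$ write $T=[t_T,t_{T+1}]$ and $|T|$ for its length. A mesh $\mathcal{T}'$ is a refinement of $\mathcal{T}$ if every element of $\mathcal{T}$ is a union of elements of $\mathcal{T}'$. $\mathcal{P}^m(\mathcal{T})$ denotes the real-valued functions on $[0,t_{\rm end}]$ that are polynomials of degree at most $m$ on each element of $\mathcal{T}$ (understood as $L^2$-functions), and $\mathcal{P}^m(T)$ the polynomials of degree at most $m$ on $T$. For $T\in\mathcal{T}$, $\mathcal{T}_T$ is the uniform partition of $T$ into three equal subintervals if $k=2$ and two equal subintervals if $k>2$. $\mathcal{P}^{k-2}(\mathcal{T}_T)$ is the space of piecewise polynomials of degree at most $k-2$ on $\mathcal{T}_T$. Fix a function $\Psi_{[0,1]}\in\mathcal{P}^{k-2}(\mathcal{T}_{[0,1]})$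 with $\int_0^1\Psi_{[0,1]}v\,ds=v(1)$ for all $v\in\mathcal{P}^k([0,1])$ (such a function exists), and set $\Psi_T(t):=|T|^{-1}\Psi_{[0,1]}((t-t_T)/|T|)$ for $t\in T$, so that $\Psi_T\in\mathcal{P}^{k-2}(\mathcal{T}_T)$ and $\int_T\Psi_Tv\,ds=v(t_{T+1})$ for all $v\in\mathcal{P}^k(T)$. Set $\Phi_T:=|T|\Psi_T$, extended by zero outside $T$. The ansatz space is $\mathcal{X}_{\mathcal{T}}:=\{v\in H^1(0,t_{\rm end};V): v|_T\text{ is a }V\text{-valued polynomial of degree at most }k\text{ for all }T\in\mathcal{T}\}$. The test space is $\mathcal{Y}_{\mathcal{T}}:={\rm span}\{v\Phi_T: T\in\mathcal{T},\,v\in V\}+{\rm span}\{v\chi:\chi\in\mathcal{P}^{k-2}(\mathcal{T}),\,v\in V\}$. *)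

theory Defs
  imports
    "HOL-Analysis.Analysis"
    "HOL-Computational_Algebra.Polynomial"
    "HOL-Library.Function_Algebras"
begin

text \<open>
  Pointwise scalar multiplication, so that the library's \<open>span\<close> is available for
  sets of vector-valued functions.
\<close>

instantiation "fun" :: (type, real_vector) real_vector
begin

definition scaleR_fun :: "real \<Rightarrow> ('a \<Rightarrow> 'b) \<Rightarrow> 'a \<Rightarrow> 'b"
  where "scaleR_fun c f = (\<lambda>x. c *\<^sub>R f x)"

instance
  by standard (auto simp: scaleR_fun_def fun_eq_iff scaleR_add_left scaleR_add_right)

end

text \<open>
  An element of a function space over \<open>[0, t_end]\<close> is a class of functions modulo equality
  almost everywhere. Such a space is represented below by the set of all representatives, as
  functions on \<open>real\<close> with arbitrary values outside \<open>[0, t_end]\<close>. All spaces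
  \<open>pw_poly\<close>, \<open>H1\<close>, \<open>X_space\<close>, \<open>Y_space\<close> are closed under equality almost everywhere on
  \<open>[0, t_end]\<close>, so that inclusion between these sets is inclusion between the spaces of classes.
\<close>

definition time_mesh :: "real \<Rightarrow> real set set \<Rightarrow> bool" where
  "time_mesh tend M \<longleftrightarrow>
     (\<exists>(n::nat) (t::nat \<Rightarrow> real). t 0 = 0 \<and> t n = tend \<and> (\<forall>i\<in>{1..n}. t (i - 1) < t i) \<and>
        M = {{t (i - 1)..t i} | i. i \<in> {1..n}})"

definition refinement :: "real set set \<Rightarrow> real set set \<Rightarrow> bool" where
  "refinement M' M \<longleftrightarrow> (\<forall>T\<in>M. \<exists>N\<subseteq>M'. T = \<Union>N)"

text \<open>Length of \<open>T = [t_T, t_(T+1)]\<close>; the end points are \<open>Inf T\<close> and \<open>Sup T\<close>.\<close>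

definition len :: "real set \<Rightarrow> real" where
  "len T = Sup T - Inf T"

definition unif_part :: "nat \<Rightarrow> real set \<Rightarrow> real set set" where
  "unif_part k T =
     (let n = (if k = 2 then 3 else 2 :: nat) in
       {{Inf T + real i * (len T / real n)..Inf T + real (i + 1) * (len T / real n)} | i. i < n})"

text \<open>Scalar piecewise polynomials of degree at most \<open>m\<close> on a set \<open>M\<close> of intervals.\<close>

definition pw_poly :: "nat \<Rightarrow> real set set \<Rightarrow> (real \<Rightarrow> real) set" where
  "pw_poly m M =
     {f. \<forall>T\<in>M. \<exists>p :: real poly. degree p \<le> m \<and> (AE t in lebesgue_on T. f t = poly p t)}"

definition reference_Psi :: "nat \<Rightarrow> (real \<Rightarrow> real) \<Rightarrow> bool" where
  "reference_Psi k \<Psi> \<longleftrightarrow>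
     \<Psi> \<in> pw_poly (k - 2) (unif_part k {0..1}) \<and>
     (\<forall>v :: real poly. degree v \<le> k \<longrightarrow> (LINT s:{0..1}|lebesgue. \<Psi> s * poly v s) = poly v 1)"

definition Psi :: "(real \<Rightarrow> real) \<Rightarrow> real set \<Rightarrow> real \<Rightarrow> real" where
  "Psi \<Psi> T t = \<Psi> ((t - Inf T) / len T) / len T"

definition Phi :: "(real \<Rightarrow> real) \<Rightarrow> real set \<Rightarrow> real \<Rightarrow> real" where
  "Phi \<Psi> T t = (if t \<in> T then len T * Psi \<Psi> T t else 0)"

definition L2 :: "real \<Rightarrow> (real \<Rightarrow> 'v::{real_inner, banach, second_countable_topology}) set" where
  "L2 tend = {f. f \<in> borel_measurable (lebesgue_on {0<..<tend}) \<and>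
     integrable (lebesgue_on {0<..<tend}) (\<lambda>t. (norm (f t))\<^sup>2)}"

text \<open>Smooth scalar functions with compact support in \<open>(0, t_end)\<close>.\<close>

definition test_functions :: "real \<Rightarrow> (real \<Rightarrow> real) set" where
  "test_functions tend =
     {\<phi>. (\<forall>n. (deriv ^^ n) \<phi> differentiable_on UNIV) \<and>
         compact (closure {t. \<phi> t \<noteq> 0}) \<and> closure {t. \<phi> t \<noteq> 0} \<subseteq> {0<..<tend}}"

definition H1 :: "real \<Rightarrow> (real \<Rightarrow> 'v::{real_inner, banach, second_countable_topology}) set" where
  "H1 tend = {f \<in> L2 tend. \<exists>g \<in> L2 tend. \<forall>\<phi> \<in> test_functions tend.
     integral\<^sup>L (lebesgue_on {0<..<tend}) (\<lambda>t. deriv \<phi> t *\<^sub>R f t) =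
     - integral\<^sup>L (lebesgue_on {0<..<tend}) (\<lambda>t. \<phi> t *\<^sub>R g t)}"

definition X_space ::
  "real \<Rightarrow> nat \<Rightarrow> real set set \<Rightarrow> (real \<Rightarrow> 'v::{real_inner, banach, second_countable_topology}) set"
where
  "X_space tend k M = {f \<in> H1 tend. \<forall>T\<in>M. \<exists>c :: nat \<Rightarrow> 'v.
     AE t in lebesgue_on T. f t = (\<Sum>i\<le>k. t ^ i *\<^sub>R c i)}"

definition Y_space ::
  "real \<Rightarrow> nat \<Rightarrow> (real \<Rightarrow> real) \<Rightarrow> real set set \<Rightarrow>
     (real \<Rightarrow> 'v::{real_inner, banach, second_countable_topology}) set"
where
  "Y_space tend k \<Psi> M = {f.
     \<exists>g \<in> span {(\<lambda>t. Phi \<Psi> T t *\<^sub>R v) | T v. T \<in> M} +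
          span {(\<lambda>t. q t *\<^sub>R v) | q v. q \<in> pw_poly (k - 2) M}.
     AE t in lebesgue_on {0..tend}. f t = g t}"

end

theory Submission
  imports Defs
begin

text \<open>
  Two elements of a mesh that share an interior point coincide, so an element of \<open>M'\<close> is
  contained in every union of elements of \<open>M'\<close> that meets its interior. Hence elements of
  \<open>M'\<close> lie in elements of \<open>M\<close>, and piecewise polynomials on \<open>M\<close> remain so on \<open>M'\<close>.
  If \<open>T \<in> M - M'\<close>, the elements of \<open>M'\<close> meeting \<open>T\<close> in an interior point even lie in
  elements of \<open>unif_part k T\<close>, so \<open>Phi \<Psi> T\<close> is itself a piecewise polynomial of degree
  \<open>k - 2\<close> on \<open>M'\<close>: the first family of generators is absorbed by the second one.
\<close>

section \<open>Almost-everywhere statements under restriction and affine maps\<close>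

text \<open>Negligible sets are stable under subsets and differentiable images; this form makes both
  facts available for exceptional sets.\<close>

lemma AE_lebesgue_on_iff_negligible:
  fixes S :: "'a::euclidean_space set"
  assumes "S \<in> sets lebesgue"
  shows "(AE t in lebesgue_on S. P t) \<longleftrightarrow> negligible {t \<in> S. \<not> P t}"
proof -
  have "(AE t in lebesgue_on S. P t) \<longleftrightarrow> (AE t in lebesgue. t \<in> S \<longrightarrow> P t)"
    using assms by (simp add: AE_restrict_space_iff)
  also have "\<dots> \<longleftrightarrow> negligible {t \<in> S. \<not> P t}"
    by (simp add: completion.AE_iff_null_sets negligible_iff_null_sets)
  finally show ?thesis .
qed

lemma AE_lebesgue_on_subset:
  fixes S T :: "'a::euclidean_space set"
  assumes "AE t in lebesgue_on T. P t" "S \<subseteq> T" "S \<in> sets lebesgue" "T \<in> sets lebesgue"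
  shows "AE t in lebesgue_on S. P t"
proof -
  have "negligible {t \<in> T. \<not> P t}"
    using assms by (simp add: AE_lebesgue_on_iff_negligible)
  then have "negligible {t \<in> S. \<not> P t}"
    by (rule negligible_subset) (use assms(2) in blast)
  then show ?thesis
    using assms by (simp add: AE_lebesgue_on_iff_negligible)
qed

text \<open>The exceptional set in \<open>t\<close> lies in the image of the one in \<open>x\<close>
  under the differentiable map sending \<open>x\<close> to \<open>a + L * x\<close>. This carries
  facts about \<open>\<Psi>\<close> from the unit interval to a mesh element.\<close>

lemma AE_lebesgue_on_affine:
  fixes P :: "real \<Rightarrow> bool"
  assumes "AE x in lebesgue_on {c..d}. P x" "L > 0"
  shows "AE t in lebesgue_on {a + L * c..a + L * d}. P ((t - a) / L)"
proof -
  have "negligible {x \<in> {c..d}. \<not> P x}"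
    using assms by (simp add: AE_lebesgue_on_iff_negligible)
  then have "negligible ((\<lambda>x. a + L * x) ` {x \<in> {c..d}. \<not> P x})"
    by (intro negligible_differentiable_image_negligible)
       (auto intro!: derivative_intros differentiable_at_imp_differentiable_on)
  moreover have "{t \<in> {a + L * c..a + L * d}. \<not> P ((t - a) / L)}
      \<subseteq> (\<lambda>x. a + L * x) ` {x \<in> {c..d}. \<not> P x}"
  proof
    fix t assume "t \<in> {t \<in> {a + L * c..a + L * d}. \<not> P ((t - a) / L)}"
    then show "t \<in> (\<lambda>x. a + L * x) ` {x \<in> {c..d}. \<not> P x}"
      using assms(2) by (intro image_eqI[of _ _ "(t - a) / L"]) (auto simp: field_simps)
  qed
  ultimately show ?thesis
    by (simp add: AE_lebesgue_on_iff_negligible negligible_subset)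
qed

section \<open>Time meshes and their refinements\<close>

text \<open>Serves both time meshes and uniform partitions. For \<open>n = 0\<close> the union would
  be empty while \<open>{t 0..t 0}\<close> is a singleton.\<close>

lemma UN_consecutive_intervals:
  fixes t :: "nat \<Rightarrow> 'a::linorder"
  assumes "n > 0" "\<And>j. j < n \<Longrightarrow> t j \<le> t (Suc j)"
  shows "(\<Union>j<n. {t j..t (Suc j)}) = {t 0..t n}"
proof -
  \<comment> \<open>The inequality is carried along because gluing the next interval at
    \<open>t (Suc m)\<close> requires it.\<close>
  have "(\<Union>j<Suc m. {t j..t (Suc j)}) = {t 0..t (Suc m)} \<and> t 0 \<le> t (Suc m)" if "Suc m \<le> n" for m
    using that
  proof (induction m)
    case 0
    then show ?case
      using assms(2)[of 0] by (simp add: lessThan_Suc)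
  next
    case (Suc m)
    then have "(\<Union>j<Suc m. {t j..t (Suc j)}) = {t 0..t (Suc m)}" "t 0 \<le> t (Suc m)"
      by auto
    moreover have "t (Suc m) \<le> t (Suc (Suc m))"
      using assms(2)[of "Suc m"] Suc.prems by simp
    ultimately show ?case
      by (subst lessThan_Suc) (auto simp: ivl_disj_un)
  qed
  from this[of "n - 1"] show ?thesis
    using assms(1) by simp
qed

text \<open>Shifting the index by one removes the truncated subtraction \<open>i - 1\<close> and
  presents the mesh as an image of \<open>{..<n}\<close>.\<close>

lemma time_meshE:
  assumes "time_mesh tend M"
  obtains n t where "t 0 = 0" "t n = tend" "\<And>j. j < n \<Longrightarrow> t j < t (Suc j)"
    "M = (\<lambda>j. {t j..t (Suc j)}) ` {..<n}"
proof -
  obtain n :: nat and t where t: "t 0 = 0" "t n = tend" "\<forall>i\<in>{1..n}. t (i - 1) < t i"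
    "M = {{t (i - 1)..t i} | i. i \<in> {1..n}}"
    using assms unfolding time_mesh_def by blast
  have "M = (\<lambda>i. {t (i - 1)..t i}) ` {1..n}"
    unfolding t(4) setcompr_eq_image Collect_mem_eq ..
  also have "{1..n} = Suc ` {..<n}"
    by (simp add: image_Suc_lessThan)
  finally have "M = (\<lambda>j. {t j..t (Suc j)}) ` {..<n}"
    by (simp add: image_image)
  moreover have "t j < t (Suc j)" if "j < n" for j
    using t(3)[rule_format, of "Suc j"] that by simp
  ultimately show thesis
    using that[of t n] t by blast
qed

lemma time_mesh_elem:
  assumes "time_mesh tend M" "T \<in> M"
  obtains a b where "T = {a..b}" "a < b"
proof -
  obtain n t where "\<And>j. j < n \<Longrightarrow> t j < t (Suc j)" "M = (\<lambda>j. {t j..t (Suc j)}) ` {..<n}"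
    using assms(1) by (rule time_meshE) blast
  then show thesis
    using that assms(2) by auto
qed

lemma time_mesh_sets_lebesgue:
  assumes "time_mesh tend M" "T \<in> M"
  shows "T \<in> sets lebesgue"
proof -
  obtain a b where "T = {a..b}"
    using assms by (rule time_mesh_elem)
  then show ?thesis
    by simp
qed

lemma time_mesh_Union:
  assumes "time_mesh tend M" "tend > 0"
  shows "\<Union>M = {0..tend}"
proof -
  obtain n t where t: "t 0 = 0" "t n = tend" "\<And>j. j < n \<Longrightarrow> t j < t (Suc j)"
    and M: "M = (\<lambda>j. {t j..t (Suc j)}) ` {..<n}"
    using assms(1) by (rule time_meshE) blast
  have "n > 0"
    using t assms(2) by (cases n) auto
  then show ?thesis
    using UN_consecutive_intervals[of n t] t M by (simp add: less_imp_le)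
qed

text \<open>Since \<open>x\<close> lies strictly between the end points of \<open>T\<close>,
  monotone nodes exclude that \<open>S\<close> comes before or after \<open>T\<close>, even if
  \<open>x\<close> is an end point of \<open>S\<close>.\<close>

lemma time_mesh_overlap:
  assumes "time_mesh tend M" "S \<in> M" "T \<in> M" "x \<in> S" "x \<in> interior T"
  shows "S = T"
proof -
  obtain n t where inc: "\<And>j. j < n \<Longrightarrow> t j < t (Suc j)"
    and M: "M = (\<lambda>j. {t j..t (Suc j)}) ` {..<n}"
    using assms(1) by (rule time_meshE) blast
  obtain i j where ij: "i < n" "j < n" "S = {t i..t (Suc i)}" "T = {t j..t (Suc j)}"
    using assms M by auto
  have mono: "t p \<le> t q" if "p \<le> q" "q \<le> n" for p q
    using that
  proof (induction q rule: dec_induct)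
    case (step q)
    then show ?case
      using inc[of q] by simp
  qed simp
  have x: "t i \<le> x" "x \<le> t (Suc i)" "t j < x" "x < t (Suc j)"
    using ij assms by (auto simp: interior_atLeastAtMost_real)
  have "\<not> i < j" "\<not> j < i"
    using mono[of "Suc i" j] mono[of "Suc j" i] x ij by auto
  then show ?thesis
    using ij by simp
qed

text \<open>Some element of \<open>M\<close> inside \<open>S\<close> contains \<open>x\<close>, and
  it must be \<open>T\<close>. The alternative for \<open>S\<close> covers elements of a coarser
  mesh as well as elements of \<open>unif_part\<close>.\<close>

lemma time_mesh_elem_subset:
  assumes "time_mesh tend M" "T \<in> M" "x \<in> interior T" "x \<in> S" "S \<in> M \<or> (\<exists>N\<subseteq>M. S = \<Union>N)"
  shows "T \<subseteq> S"
proof -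
  obtain R where "R \<in> M" "x \<in> R" "R \<subseteq> S"
    using assms by auto
  then show ?thesis
    using time_mesh_overlap assms by metis
qed

lemma refinement_elem_subset:
  assumes "time_mesh tend M" "time_mesh tend M'" "tend > 0" "refinement M' M" "T' \<in> M'"
  shows "\<exists>T\<in>M. T' \<subseteq> T"
proof -
  obtain a b where ab: "T' = {a..b}" "a < b"
    using assms(2,5) by (rule time_mesh_elem)
  \<comment> \<open>Any interior point of \<open>T'\<close> would do: an element of \<open>M\<close>
    containing it is a union of elements of \<open>M'\<close> and therefore contains
    \<open>T'\<close>.\<close>
  define x where "x = (a + b) / 2"
  have x: "x \<in> interior T'"
    using ab by (simp add: x_def interior_atLeastAtMost_real)
  then have "x \<in> \<Union>M"
    using assms time_mesh_Union interior_subset by (metis UnionI subsetD)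
  then obtain T where "T \<in> M" "x \<in> T"
    by blast
  then show ?thesis
    using time_mesh_elem_subset[OF assms(2,5) x] assms(4) unfolding refinement_def by meson
qed

section \<open>Uniform partitions and affine changes of variable\<close>

text \<open>Writing the nodes as \<open>a + (b - a) * (i / n)\<close> exhibits the elements as
  affine images of those of the unit interval, as \<open>AE_lebesgue_on_affine\<close>
  expects.\<close>

lemma unif_part_atLeastAtMost:
  assumes "a \<le> b"
  shows "unif_part k {a..b} = (let n = if k = 2 then 3 else 2 in
    (\<lambda>i. {a + (b - a) * (real i / real n)..a + (b - a) * (real (Suc i) / real n)}) ` {..<n})"
proof -
  have "Inf {a..b} = a" "Sup {a..b} = b"
    using assms by simp_all
  then show ?thesis
    unfolding unif_part_def len_def Let_def setcompr_eq_image lessThan_def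
    by (simp add: mult.commute[of "b - a"])
qed

lemma Union_unif_part:
  assumes "a \<le> b"
  shows "\<Union>(unif_part k {a..b}) = {a..b}"
proof -
  define n :: nat where "n = (if k = 2 then 3 else 2)"
  have "(\<Union>i<n. {a + (b - a) * (real i / real n)..a + (b - a) * (real (Suc i) / real n)})
      = {a + (b - a) * (real 0 / real n)..a + (b - a) * (real n / real n)}"
    using assms by (intro UN_consecutive_intervals)
      (auto simp: n_def intro!: mult_left_mono divide_right_mono)
  then show ?thesis
    using assms by (simp add: unif_part_atLeastAtMost Let_def n_def split: if_splits)
qed

text \<open>Composition with a polynomial of degree at most one does not raise the degree. For
  \<open>L = 0\<close> both sides equal \<open>poly p 0\<close>, as division by zero gives
  zero.\<close>

lemma poly_affine_arg:
  fixes p :: "real poly"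
  shows "\<exists>q. degree q \<le> degree p \<and> (\<forall>t. poly p ((t - a) / L) = poly q t)"
proof (intro exI conjI allI)
  let ?q = "pcompose p [:- a / L, 1 / L:]"
  show "degree ?q \<le> degree p"
    by (simp add: degree_pcompose mult_le_cancel1)
  show "poly p ((t - a) / L) = poly ?q t" for t
    by (simp add: poly_pcompose diff_divide_distrib)
qed

section \<open>Piecewise polynomials and \<open>Phi\<close> on refined meshes\<close>

lemma pw_poly_subset:
  assumes "\<And>T'. T' \<in> M' \<Longrightarrow> T' \<in> sets lebesgue \<and> (\<exists>T\<in>M. T \<in> sets lebesgue \<and> T' \<subseteq> T)"
  shows "pw_poly m M \<subseteq> pw_poly m M'"
  unfolding pw_poly_def
proof (intro subsetI CollectI ballI)
  fix f T'
  assume f: "f \<in> {f. \<forall>T\<in>M. \<exists>p. degree p \<le> m \<and> (AE t in lebesgue_on T. f t = poly p t)}"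
    and "T' \<in> M'"
  then obtain T where T: "T \<in> M" "T' \<subseteq> T" "T' \<in> sets lebesgue" "T \<in> sets lebesgue"
    using assms by meson
  then obtain p where "degree p \<le> m" "AE t in lebesgue_on T. f t = poly p t"
    using f by auto
  then show "\<exists>p. degree p \<le> m \<and> (AE t in lebesgue_on T'. f t = poly p t)"
    using AE_lebesgue_on_subset T(2-4) by metis
qed

text \<open>On \<open>{a..b}\<close> the factor \<open>len T\<close> cancels the division in
  \<open>Psi\<close>, leaving \<open>\<Psi>\<close> composed with the affine map onto the unit
  interval.\<close>

lemma Phi_pw_poly_unif_part:
  assumes "reference_Psi k \<Psi>" "a < b"
  shows "Phi \<Psi> {a..b} \<in> pw_poly (k - 2) (unif_part k {a..b})"
  unfolding pw_poly_def
proof (intro CollectI ballI)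
  fix S assume S: "S \<in> unif_part k {a..b}"
  define n :: nat where "n = (if k = 2 then 3 else 2)"
  obtain i where i: "i < n"
    "S = {a + (b - a) * (real i / real n)..a + (b - a) * (real (Suc i) / real n)}"
    using S assms(2) by (auto simp: unif_part_atLeastAtMost Let_def n_def split: if_splits)
  have "{real i / real n..real (Suc i) / real n} \<in> unif_part k {0..1}"
    unfolding unif_part_atLeastAtMost[OF zero_le_one] Let_def n_def[symmetric]
    using i(1) by (intro image_eqI[of _ _ i]) auto
  then obtain p where p: "degree p \<le> k - 2"
    "AE x in lebesgue_on {real i / real n..real (Suc i) / real n}. \<Psi> x = poly p x"
    using assms(1) unfolding reference_Psi_def pw_poly_def by blast
  obtain q where q: "degree q \<le> degree p" "\<And>t. poly p ((t - a) / (b - a)) = poly q t"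
    using poly_affine_arg[of p a "b - a"] by blast
  have ae: "AE t in lebesgue_on S. \<Psi> ((t - a) / (b - a)) = poly q t"
    unfolding i(2) q(2)[symmetric] using assms(2) by (intro AE_lebesgue_on_affine[OF p(2)]) simp
  \<comment> \<open>This keeps the extension of \<open>Phi\<close> by zero out of play on
    \<open>S\<close>.\<close>
  have "S \<subseteq> {a..b}"
    using Union_unif_part[of a b k] S assms(2) by auto
  then have "AE t in lebesgue_on S. Phi \<Psi> {a..b} t = poly q t"
    using assms(2) by (intro AE_mp[OF ae AE_I2]) (auto simp: Phi_def Psi_def len_def dest!: subsetD[of S])
  then show "\<exists>p. degree p \<le> k - 2 \<and> (AE t in lebesgue_on S. Phi \<Psi> {a..b} t = poly p t)"
    using p q by (meson le_trans)
qed

lemma Phi_pw_poly_refinement: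
  assumes "reference_Psi k \<Psi>" "time_mesh tend M'" "a < b"
    and "\<And>S. S \<in> unif_part k {a..b} \<Longrightarrow> S \<in> M' \<or> (\<exists>N\<subseteq>M'. S = \<Union>N)"
  shows "Phi \<Psi> {a..b} \<in> pw_poly (k - 2) M'"
  unfolding pw_poly_def
proof (intro CollectI ballI)
  fix T' assume T': "T' \<in> M'"
  obtain c d where cd: "T' = {c..d}"
    using assms(2) T' by (rule time_mesh_elem)
  show "\<exists>p. degree p \<le> k - 2 \<and> (AE t in lebesgue_on T'. Phi \<Psi> {a..b} t = poly p t)"
  proof (cases "interior T' \<inter> {a..b} = {}")
    case True
    \<comment> \<open>\<open>T'\<close> may still touch \<open>{a..b}\<close> at an end point, where
      \<open>Phi\<close> need not vanish.\<close>
    then have "{t \<in> T'. Phi \<Psi> {a..b} t \<noteq> poly 0 t} \<subseteq> {c, d}"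
      by (auto simp: cd Phi_def interior_atLeastAtMost_real disjoint_iff not_less split: if_splits)
       (meson antisym not_less)
    then have "AE t in lebesgue_on T'. Phi \<Psi> {a..b} t = poly 0 t"
      using time_mesh_sets_lebesgue[OF assms(2) T']
      by (subst AE_lebesgue_on_iff_negligible) (auto intro: negligible_subset[of "{c, d}"])
    then show ?thesis
      by (metis degree_0 zero_le)
  next
    case False
    then obtain x where "x \<in> interior T'" "x \<in> {a..b}"
      by blast
    moreover from this have "x \<in> \<Union>(unif_part k {a..b})"
      using Union_unif_part assms(3) by simp
    \<comment> \<open>\<open>x\<close> may be a node shared by two elements of
      \<open>unif_part\<close>; either choice of \<open>S\<close> works, because \<open>x\<close> is
      interior to \<open>T'\<close>.\<close>
    ultimately obtain S where x: "x \<in> interior T'" "x \<in> S" and S: "S \<in> unif_part k {a..b}"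
      by blast
    have "T' \<subseteq> S"
      using time_mesh_elem_subset[OF assms(2) T' x assms(4)[OF S]] .
    moreover have "S \<in> sets lebesgue"
      using S by (auto simp: unif_part_def Let_def)
    moreover obtain p where "degree p \<le> k - 2" "AE t in lebesgue_on S. Phi \<Psi> {a..b} t = poly p t"
      using Phi_pw_poly_unif_part[OF assms(1,3)] S unfolding pw_poly_def by auto
    ultimately show ?thesis
      using AE_lebesgue_on_subset time_mesh_sets_lebesgue[OF assms(2) T'] by metis
  qed
qed

section \<open>Inclusions of the ansatz and test spaces\<close>

text \<open>With a single span of a union, inclusion of test spaces reduces to inclusion of
  generating sets.\<close>

lemma Y_space_altdef:
  "(Y_space tend k \<Psi> M :: (real \<Rightarrow> 'a::{real_inner, banach, second_countable_topology}) set) =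
    {f. \<exists>g \<in> span ({\<lambda>t. Phi \<Psi> T t *\<^sub>R v | T v. T \<in> M} \<union>
      {\<lambda>t. q t *\<^sub>R v | q v. q \<in> pw_poly (k - 2) M}). AE t in lebesgue_on {0..tend}. f t = g t}"
proof -
  have "span (A \<union> B) = span A + span B" for A B :: "(real \<Rightarrow> 'a) set"
    unfolding span_Un set_plus_def by blast
  then show ?thesis
    unfolding Y_space_def by simp
qed

text \<open>Membership in \<open>H1\<close> does not involve the mesh, and on \<open>T'\<close> the
  coefficients of the surrounding element \<open>T\<close> are reused.\<close>

lemma X_space_refinement:
  assumes "time_mesh tend M" "time_mesh tend M'" "tend > 0" "refinement M' M"
  shows "(X_space tend k M :: (real \<Rightarrow> 'a::{real_inner, banach, second_countable_topology}) set)
    \<subseteq> X_space tend k M'"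
proof -
  have "\<exists>c. AE t in lebesgue_on T'. f t = (\<Sum>i\<le>k. t ^ i *\<^sub>R c i)"
    if f: "\<forall>T\<in>M. \<exists>c. AE t in lebesgue_on T. f t = (\<Sum>i\<le>k. t ^ i *\<^sub>R c i)" and T': "T' \<in> M'"
    for f :: "real \<Rightarrow> 'a" and T'
  proof -
    obtain T where T: "T \<in> M" "T' \<subseteq> T"
      using refinement_elem_subset[OF assms T'] by blast
    then obtain c where "AE t in lebesgue_on T. f t = (\<Sum>i\<le>k. t ^ i *\<^sub>R c i)"
      using f by auto
    from AE_lebesgue_on_subset[OF this T(2)] show ?thesis
      using time_mesh_sets_lebesgue assms T T' by auto
  qed
  then show ?thesis
    unfolding X_space_def by auto
qed

lemma Y_space_refinement:
  assumes "reference_Psi k \<Psi>" "time_mesh tend M" "time_mesh tend M'" "tend > 0" "refinement M' M"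
    and "\<forall>T \<in> M - M'. \<forall>S \<in> unif_part k T. S \<in> M' \<or> (\<exists>N \<subseteq> M'. S = \<Union>N)"
  shows "(Y_space tend k \<Psi> M :: (real \<Rightarrow> 'a::{real_inner, banach, second_countable_topology}) set)
    \<subseteq> Y_space tend k \<Psi> M'"
proof -
  have pw: "pw_poly (k - 2) M \<subseteq> pw_poly (k - 2) M'"
  proof (rule pw_poly_subset)
    fix T' assume "T' \<in> M'"
    then show "T' \<in> sets lebesgue \<and> (\<exists>T\<in>M. T \<in> sets lebesgue \<and> T' \<subseteq> T)"
      using refinement_elem_subset[OF assms(2-5)] time_mesh_sets_lebesgue assms(2,3) by meson
  qed
  \<comment> \<open>An element kept in \<open>M'\<close> keeps its own generator; for a refined one,
    \<open>q = Phi \<Psi> T\<close> gives a generator of the second family.\<close>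
  have "T \<in> M' \<or> Phi \<Psi> T \<in> pw_poly (k - 2) M'" if T: "T \<in> M" for T
  proof (cases "T \<in> M'")
    case False
    obtain a b where ab: "T = {a..b}" "a < b"
      using assms(2) T by (rule time_mesh_elem)
    have "Phi \<Psi> {a..b} \<in> pw_poly (k - 2) M'"
    proof (rule Phi_pw_poly_refinement[OF assms(1,3) ab(2)])
      show "S \<in> M' \<or> (\<exists>N\<subseteq>M'. S = \<Union>N)" if "S \<in> unif_part k {a..b}" for S
        using assms(6) T False ab(1) that by simp
    qed
    then show ?thesis
      using ab(1) by simp
  qed simp
  then have "(\<exists>T\<in>M'. f = (\<lambda>t. Phi \<Psi> T t *\<^sub>R v)) \<or> (\<exists>q\<in>pw_poly (k - 2) M'. f = (\<lambda>t. q t *\<^sub>R v))"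
    if "T \<in> M" "f = (\<lambda>t. Phi \<Psi> T t *\<^sub>R v)" for T f and v :: 'a
    using that by auto
  then have "{\<lambda>t. Phi \<Psi> T t *\<^sub>R v | T v. T \<in> M} \<union> {\<lambda>t. q t *\<^sub>R (v::'a) | q v. q \<in> pw_poly (k - 2) M}
      \<subseteq> {\<lambda>t. Phi \<Psi> T t *\<^sub>R v | T v. T \<in> M'} \<union> {\<lambda>t. q t *\<^sub>R v | q v. q \<in> pw_poly (k - 2) M'}"
    (is "?G \<subseteq> ?G'")
    using pw by blast
  then have "span ?G \<subseteq> span ?G'"
    by (rule span_mono)
  then show ?thesis
    unfolding Y_space_altdef by (intro Collect_mono impI, elim bexE) (rule bexI, assumption, erule subsetD)
qed

theorem lemma2p3:
  fixes k :: nat and tend :: real and M M' :: "real set set" and \<Psi> :: "real \<Rightarrow> real"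
  assumes "\<exists>B :: 'v::{real_inner, banach, second_countable_topology} set. finite B \<and> span B = UNIV"
    and "k \<ge> 2"
    and "tend > 0"
    and "reference_Psi k \<Psi>"
    and "time_mesh tend M"
    and "time_mesh tend M'"
    and "refinement M' M"
  shows "(X_space tend k M :: (real \<Rightarrow> 'v) set) \<subseteq> X_space tend k M' \<and>
    ((\<forall>T \<in> M - M'. \<forall>S \<in> unif_part k T. S \<in> M' \<or> (\<exists>N \<subseteq> M'. S = \<Union>N)) \<longrightarrow>
      (Y_space tend k \<Psi> M :: (real \<Rightarrow> 'v) set) \<subseteq> Y_space tend k \<Psi> M')"
  using X_space_refinement[OF assms(5,6,3,7)] Y_space_refinement[OF assms(4,5,6,3,7)]
  by (intro conjI impI)

end
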